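(* Let $(G,+)$ be a finite group with $|G|>1$, let $\Phi$ be a group of fixed-point-free automorphisms on $(G,+)$, and let $S\subseteq\Phi\cup\{\mathbf{0}\}$ with $|S|>1$. Put $\mathbf{B}=\{S(x)\mid x\in G^*\}$. Let $\mu,\nu$ be positive integers such that (1) $|G_{S(a)}|=\mu$ for all $a\in G^*$; (2) $|S(a)/\!\sim|=\nu$ for all $a\in G^*$. Then $\mathbf{B}=\{S(x)\mid x\in G^*\}$ is a $\left(|G|,|S|,\frac{|S|\cdot(|S|-1)}{\mu\nu}\right)$-short difference family in $G$.
   Context: Groups are written additively but need not be abelian. For a finite group $(G,+)$, $G^*=G\setminus\{0\}$; $\mathbf{0}$ is the map $G\to G$, $x\mapsto 0$. A group $\Phi$ of automorphisms of $(G,+)$ is fixed-point-free (fpf) iff $|\Phi(x)|=|\Phi|$ for all $x\in G^*$, where $\Phi(x)=\{\varphi(x)\mid\varphi\in\Phi\}$. For a set $S$ of endomorphisms and $x\in G$, $S(x)=\{\alpha(x)\mid\alpha\in S\}$. For $B\subseteq G$ and $g\in G$, $B+g=\{b+g\mid b\in B\}$ and $G_B=\{g\in G\mid B+g=B\}$. Equivalence: for a set $\mathbf{B}$ of subsets of $G$ and $B,C\in\mathbf{B}$, put $B\sim C$ iff there is $g\in G$ with $B=C+g$. This is an equivalence relation on $\mathbf{B}$, and $B/\!\sim$ denotes the equivalence class of $B$ in $\mathbf{B}$. Short difference family (sdf): let $\mathbf{B}$ be a set of subsets of the finite group $(G,+)$ with $v=|G|>1$, and let $k,\mu,\nu,\lambda'$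 be positive integers such that (1) $|B|=k$ for all $B\in\mathbf{B}$; (2) $|G_B|=\mu$ for all $B\in\mathbf{B}$; (3) $|B/\!\sim|=\nu$ for all $B\in\mathbf{B}$; (4) $|\{(B,a,b)\mid B\in\mathbf{B},\ a,b\in B,\ a-b=d\}|=\lambda'$ for all $d\in G$, $d\neq 0$. Then $\mathbf{B}$ is called a $(v,k,\frac{\lambda'}{\mu\nu})$-short difference family in $G$.
   Formalization: In (2), |S(a)/~| is counted with multiplicity, as the number of x in G* with S(x) ~ S(a); if distinct blocks are counted, the claim fails whenever x -> S(x) is not injective, e.g. for G = Z_5, S = Phi = {1,-1}, where the parameter is 1, not 2. *)

theory Defs
  imports Complex_Main "HOL-Algebra.Bij" "HOL-Algebra.Coset"
begin

text \<open>
  Groups are HOL-Algebra groups, hence written multiplicatively and not assumed commutative: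
  the additive \<open>a + b\<close>, \<open>a - b\<close>, \<open>0\<close>, \<open>B + g\<close> are
  \<open>a \<otimes> b\<close>, \<open>a \<otimes> inv b\<close>, \<open>\<one>\<close>, \<open>B #> g\<close>.
  Maps on the group are extensional functions on the carrier, as in \<^const>\<open>AutoGroup\<close>.
\<close>

definition nonzero :: "('a, 'b) monoid_scheme \<Rightarrow> 'a set" where
  "nonzero G = carrier G - {\<one>\<^bsub>G\<^esub>}"

definition zero_map :: "('a, 'b) monoid_scheme \<Rightarrow> 'a \<Rightarrow> 'a" where
  "zero_map G = (\<lambda>x\<in>carrier G. \<one>\<^bsub>G\<^esub>)"

definition values_at :: "('a \<Rightarrow> 'a) set \<Rightarrow> 'a \<Rightarrow> 'a set" where
  "values_at S x = {\<alpha> x | \<alpha>. \<alpha> \<in> S}"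

definition fpf_automorphism_group ::
    "('a, 'b) monoid_scheme \<Rightarrow> ('a \<Rightarrow> 'a) set \<Rightarrow> bool" where
  "fpf_automorphism_group G \<Phi> \<longleftrightarrow>
     subgroup \<Phi> (AutoGroup G) \<and> (\<forall>x\<in>nonzero G. card (values_at \<Phi> x) = card \<Phi>)"

definition translation_stabilizer :: "('a, 'b) monoid_scheme \<Rightarrow> 'a set \<Rightarrow> 'a set" where
  "translation_stabilizer G B = {g \<in> carrier G. B #>\<^bsub>G\<^esub> g = B}"

definition translate_equiv :: "('a, 'b) monoid_scheme \<Rightarrow> 'a set \<Rightarrow> 'a set \<Rightarrow> bool" where
  "translate_equiv G B C \<longleftrightarrow> (\<exists>g\<in>carrier G. B = C #>\<^bsub>G\<^esub> g)"

text \<open>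
  Blocks are given as a family \<open>(B i)\<close> for \<open>i \<in> I\<close>, and a block occurring for several indices
  is counted that many times. A set \<open>\<B>\<close> of blocks is the family \<open>(B)\<close> for \<open>B \<in> \<B>\<close>, with
  \<open>I = \<B>\<close> and the identity map.

  The distinction matters for \<open>S(x)\<close>, which need not be injective in \<open>x\<close>: for
  \<open>S = \<Phi> = {1, -1}\<close> on the integers modulo 5, the set of blocks \<open>{{1,4}, {2,3}}\<close> has
  \<open>\<mu> = \<nu> = \<lambda>' = 1\<close>, while the family indexed by the nonzero \<open>x\<close> has
  \<open>\<mu> = 1\<close>, \<open>\<nu> = 2\<close>, \<open>\<lambda>' = |S| (|S| - 1) = 2\<close>; the quotient is 1 for both.
\<close>

definition block_class ::
    "('a, 'b) monoid_scheme \<Rightarrow> 'i set \<Rightarrow> ('i \<Rightarrow> 'a set) \<Rightarrow> 'i \<Rightarrow> 'i set" where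
  "block_class G I B i = {j \<in> I. translate_equiv G (B i) (B j)}"

text \<open>
  All the data of a short difference family: \<open>l\<close> is the number written \<open>\<lambda>'\<close> in the
  parameter triple \<open>(v, k, \<lambda>' / (\<mu> \<nu>))\<close>.
\<close>

definition sdf_data ::
    "('a, 'b) monoid_scheme \<Rightarrow> 'i set \<Rightarrow> ('i \<Rightarrow> 'a set) \<Rightarrow>
      nat \<Rightarrow> nat \<Rightarrow> nat \<Rightarrow> nat \<Rightarrow> nat \<Rightarrow> bool" where
  "sdf_data G I B v k \<mu> \<nu> l \<longleftrightarrow>
     group G \<and> finite (carrier G) \<and> v = order G \<and> 1 < v \<and>
     0 < k \<and> 0 < \<mu> \<and> 0 < \<nu> \<and> 0 < l \<and>
     (\<forall>i\<in>I. B i \<subseteq> carrier G) \<and>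
     (\<forall>i\<in>I. card (B i) = k) \<and>
     (\<forall>i\<in>I. card (translation_stabilizer G (B i)) = \<mu>) \<and>
     (\<forall>i\<in>I. card (block_class G I B i) = \<nu>) \<and>
     (\<forall>d\<in>nonzero G.
        card {(i, a, b). i \<in> I \<and> a \<in> B i \<and> b \<in> B i \<and> a \<otimes>\<^bsub>G\<^esub> inv\<^bsub>G\<^esub> b = d} = l)"

definition short_difference_family ::
    "('a, 'b) monoid_scheme \<Rightarrow> 'a set set \<Rightarrow> nat \<Rightarrow> nat \<Rightarrow> rat \<Rightarrow> bool" where
  "short_difference_family G \<B> v k q \<longleftrightarrow>
     (\<exists>\<mu> \<nu> l. sdf_data G \<B> (\<lambda>B. B) v k \<mu> \<nu> l \<and> q = of_nat l / (of_nat \<mu> * of_nat \<nu>))"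

end

theory Submission
  imports Defs
begin

text \<open>
  Two distinct elements \<open>s, t\<close> of \<open>\<Phi> \<union> {0}\<close> agree only at the neutral element. Hence
  \<open>x \<mapsto> s x - t x\<close> is injective, so it is a permutation of \<open>G\<close>, and every \<open>d \<noteq> 0\<close> is attained
  exactly once for each ordered pair \<open>s \<noteq> t\<close> in \<open>S\<close>; this gives \<open>\<lambda>' = |S| (|S| - 1)\<close> for the
  indexed family. The fibre of \<open>x \<mapsto> S(x)\<close> through \<open>x\<close> consists of the \<open>\<phi> x\<close> with \<open>\<phi> \<in> \<Phi>\<close> and
  \<open>S \<phi> = S\<close>, so all fibres have the same size \<open>m\<close>. Passing from the indexed family to the set of
  blocks therefore divides both \<open>\<nu>\<close> and \<open>\<lambda>'\<close> by \<open>m\<close>, which leaves the quotient unchanged.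
\<close>

section \<open>Counting along fibres, and the passage from an indexed family to its set of
  blocks\<close>

lemma sum_const_fibres:
  fixes g :: "'b \<Rightarrow> nat"
  assumes "finite I" and "\<And>C. C \<in> f ` I \<Longrightarrow> card {i \<in> I. f i = C} = m"
  shows "(\<Sum>i\<in>I. g (f i)) = m * (\<Sum>C\<in>f ` I. g C)"
proof -
  have "(\<Sum>i\<in>I. g (f i)) = (\<Sum>C\<in>f ` I. \<Sum>i | i \<in> I \<and> f i = C. g (f i))"
    by (rule sum.image_gen) (rule assms(1))
  also have "\<dots> = (\<Sum>C\<in>f ` I. m * g C)"
    using assms(2) by (intro sum.cong) auto
  finally show ?thesis
    by (simp add: sum_distrib_left)
qed

lemma nonzero_nonempty:
  assumes "1 < order G"
  shows "nonzero G \<noteq> {}"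
proof
  assume "nonzero G = {}"
  then have "carrier G \<subseteq> {\<one>\<^bsub>G\<^esub>}"
    by (auto simp: nonzero_def)
  then have "order G \<le> card {\<one>\<^bsub>G\<^esub>}"
    unfolding order_def by (intro card_mono) auto
  with assms show False by simp
qed

lemma card_block_class:
  assumes "finite I"
  shows "card (block_class G I B i) = (\<Sum>j\<in>I. of_bool (translate_equiv G (B i) (B j)))"
  using assms by (simp add: block_class_def of_bool_def sum.If_cases Int_def)

lemma card_differences:
  assumes "finite I" and "\<And>i. i \<in> I \<Longrightarrow> finite (B i)"
  shows "card {(i, a, b). i \<in> I \<and> a \<in> B i \<and> b \<in> B i \<and> a \<otimes>\<^bsub>G\<^esub> inv\<^bsub>G\<^esub> b = d} =
    (\<Sum>i\<in>I. card {(a, b). a \<in> B i \<and> b \<in> B i \<and> a \<otimes>\<^bsub>G\<^esub> inv\<^bsub>G\<^esub> b = d})"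
proof -
  have "{(i, a, b). i \<in> I \<and> a \<in> B i \<and> b \<in> B i \<and> a \<otimes>\<^bsub>G\<^esub> inv\<^bsub>G\<^esub> b = d} =
      (SIGMA i:I. {(a, b). a \<in> B i \<and> b \<in> B i \<and> a \<otimes>\<^bsub>G\<^esub> inv\<^bsub>G\<^esub> b = d})"
    by auto
  moreover have "finite {(a, b). a \<in> B i \<and> b \<in> B i \<and> a \<otimes>\<^bsub>G\<^esub> inv\<^bsub>G\<^esub> b = d}" if "i \<in> I" for i
    by (rule finite_subset[of _ "B i \<times> B i"]) (use assms(2)[OF that] in auto)
  ultimately show ?thesis
    using assms(1) by (simp add: card_SigmaI)
qed

text \<open>Class sizes and difference counts are sums over \<open>I\<close> of quantities that
  depend only on the block \<open>B i\<close>, so collapsing fibres of size \<open>m\<close> divides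
  both by \<open>m\<close>. Block size and stabilizer are properties of a single block and stay as
  they are.\<close>

lemma short_difference_family_image:
  assumes sdf: "sdf_data G I B v k \<mu> \<nu> l"
    and fin: "finite I" and ne: "I \<noteq> {}"
    and fib: "\<And>C. C \<in> B ` I \<Longrightarrow> card {i \<in> I. B i = C} = m"
  shows "short_difference_family G (B ` I) v k (of_nat l / (of_nat \<mu> * of_nat \<nu>))"
proof -
  have G: "finite (carrier G)" "1 < order G" and pos: "0 < \<nu>" "0 < l"
    and sub: "\<And>i. i \<in> I \<Longrightarrow> B i \<subseteq> carrier G"
    and cls: "\<And>i. i \<in> I \<Longrightarrow> card (block_class G I B i) = \<nu>"
    and dif: "\<And>d. d \<in> nonzero G \<Longrightarrow>
        card {(i, a, b). i \<in> I \<and> a \<in> B i \<and> b \<in> B i \<and> a \<otimes>\<^bsub>G\<^esub> inv\<^bsub>G\<^esub> b = d} = l"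
    using sdf by (auto simp: sdf_data_def)
  have fB: "finite (B i)" if "i \<in> I" for i
    using sub[OF that] G(1) by (rule finite_subset)
  \<comment> \<open>The weight summed over the fibres is the indicator of being equivalent to the
    fixed block \<open>B i\<close>.\<close>
  have cls': "m * card (block_class G (B ` I) (\<lambda>C. C) (B i)) = \<nu>" if "i \<in> I" for i
    using cls[OF that]
      sum_const_fibres[OF fin fib, where g = "\<lambda>C. of_bool (translate_equiv G (B i) C)"]
    by (simp add: card_block_class fin)
  have dif': "m * card {(C, a, b). C \<in> B ` I \<and> a \<in> C \<and> b \<in> C \<and> a \<otimes>\<^bsub>G\<^esub> inv\<^bsub>G\<^esub> b = d} = l"
    if "d \<in> nonzero G" for d
  proof -
    have "m * card {(C, a, b). C \<in> B ` I \<and> a \<in> C \<and> b \<in> C \<and> a \<otimes>\<^bsub>G\<^esub> inv\<^bsub>G\<^esub> b = d} =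
        m * (\<Sum>C\<in>B ` I. card {(a, b). a \<in> C \<and> b \<in> C \<and> a \<otimes>\<^bsub>G\<^esub> inv\<^bsub>G\<^esub> b = d})"
      by (subst card_differences) (use fin fB in auto)
    also have "\<dots> = (\<Sum>i\<in>I. card {(a, b). a \<in> B i \<and> b \<in> B i \<and> a \<otimes>\<^bsub>G\<^esub> inv\<^bsub>G\<^esub> b = d})"
      by (rule sum_const_fibres[OF fin fib, symmetric])
    also have "\<dots> = l"
      using dif[OF that] card_differences[where B = B, OF fin fB, of G d] by simp
    finally show ?thesis .
  qed
  \<comment> \<open>A single index and a single difference exhibit \<open>m\<close> as a divisor of
    \<open>\<nu>\<close> and of \<open>l\<close>. Since \<open>\<nu>\<close> is positive, so is
    \<open>m\<close>, and it can be cancelled at every other index and difference, giving the same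
    \<open>\<nu>'\<close> and \<open>l'\<close>.\<close>
  obtain i where i: "i \<in> I"
    using ne by blast
  obtain d where d: "d \<in> nonzero G"
    using nonzero_nonempty[OF G(2)] by blast
  obtain \<nu>' l' where eq: "\<nu> = m * \<nu>'" "l = m * l'"
    using cls'[OF i] dif'[OF d] by blast
  have "0 < m"
    using eq(1) pos(1) by simp
  have "sdf_data G (B ` I) (\<lambda>C. C) v k \<mu> \<nu>' l'"
    unfolding sdf_data_def
  proof (intro conjI ballI)
    fix C assume "C \<in> B ` I"
    then show "card (block_class G (B ` I) (\<lambda>C. C) C) = \<nu>'"
      using cls' eq(1) \<open>0 < m\<close> by auto
  next
    fix d assume "d \<in> nonzero G"
    from dif'[OF this]
    show "card {(C, a, b). C \<in> B ` I \<and> a \<in> C \<and> b \<in> C \<and> a \<otimes>\<^bsub>G\<^esub> inv\<^bsub>G\<^esub> b = d} = l'"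
      using eq(2) \<open>0 < m\<close> by simp
  qed (use sdf eq in \<open>auto simp: sdf_data_def\<close>)
  moreover have "(of_nat l :: rat) / (of_nat \<mu> * of_nat \<nu>) = of_nat l' / (of_nat \<mu> * of_nat \<nu>')"
    using eq \<open>0 < m\<close> by (simp add: mult.left_commute)
  ultimately show ?thesis
    unfolding short_difference_family_def by blast
qed

section \<open>Fixed-point-free automorphism groups, extended by the zero map\<close>

lemma values_at_eq_image: "values_at S x = (\<lambda>\<alpha>. \<alpha> x) ` S"
  by (auto simp: values_at_def)

locale fpf_automorphisms = group G for G :: "('a, 'b) monoid_scheme" (structure) +
  fixes \<Phi> :: "('a \<Rightarrow> 'a) set"
  assumes finite_carrier: "finite (carrier G)"
    and fpf: "fpf_automorphism_group G \<Phi>"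
begin

lemma \<Phi>_auto: "\<phi> \<in> \<Phi> \<Longrightarrow> \<phi> \<in> auto G"
  using fpf subgroup.subset unfolding fpf_automorphism_group_def AutoGroup_def by fastforce

lemma finite_\<Phi>: "finite \<Phi>"
proof (rule finite_subset)
  show "\<Phi> \<subseteq> carrier G \<rightarrow>\<^sub>E carrier G"
    using \<Phi>_auto by (auto simp: auto_def PiE_def dest: Bij_imp_extensional Bij_imp_funcset)
qed (simp add: finite_PiE finite_carrier)

lemma hom: "\<alpha> \<in> \<Phi> \<union> {zero_map G} \<Longrightarrow> \<alpha> \<in> hom G G"
  using \<Phi>_auto by (auto simp: auto_def zero_map_def hom_def)

lemma automorphism_nonzero:
  assumes "\<phi> \<in> \<Phi>" "x \<in> nonzero G"
  shows "\<phi> x \<in> nonzero G"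
proof -
  have "\<phi> \<in> hom G G" "inj_on \<phi> (carrier G)"
    using \<Phi>_auto[OF assms(1)] by (auto simp: auto_def Bij_def bij_betw_def)
  moreover from this(1) have "\<phi> \<one> = \<one>"
    by (rule hom_one) (rule group_axioms)+
  moreover have "x \<in> carrier G" "x \<noteq> \<one>"
    using assms(2) by (auto simp: nonzero_def)
  ultimately show ?thesis
    unfolding nonzero_def by (metis DiffI hom_in_carrier inj_onD one_closed singletonD)
qed

text \<open>On the finite set \<open>\<Phi>\<close>, fixed-point-freeness says that evaluation at
  \<open>x\<close> has an image as large as its domain. The zero map stays apart because
  automorphisms keep \<open>x\<close> nonzero.\<close>

lemma inj_on_eval:
  assumes x: "x \<in> nonzero G"
  shows "inj_on (\<lambda>\<alpha>. \<alpha> x) (\<Phi> \<union> {zero_map G})"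
proof -
  have "inj_on (\<lambda>\<alpha>. \<alpha> x) \<Phi>"
    using fpf x finite_\<Phi>
    by (intro eq_card_imp_inj_on) (auto simp: fpf_automorphism_group_def values_at_eq_image)
  moreover have "\<phi> x \<noteq> zero_map G x" if "\<phi> \<in> \<Phi>" for \<phi>
    using x automorphism_nonzero[OF that x] by (simp add: zero_map_def nonzero_def)
  ultimately show ?thesis
    by (fastforce simp: inj_on_def)
qed

lemma compose_closed:
  assumes "\<phi> \<in> \<Phi>" "\<psi> \<in> \<Phi>"
  shows "compose (carrier G) \<phi> \<psi> \<in> \<Phi>"
proof -
  have "\<phi> \<otimes>\<^bsub>AutoGroup G\<^esub> \<psi> \<in> \<Phi>"
    using fpf assms by (auto simp: fpf_automorphism_group_def intro: subgroup.m_closed)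
  \<comment> \<open>Multiplication in \<open>BijGroup\<close> is restricted to \<open>Bij\<close>,
    so it unfolds to \<open>compose\<close> only for maps known to be bijections.\<close>
  moreover have "\<phi> \<in> Bij (carrier G)" "\<psi> \<in> Bij (carrier G)"
    using assms \<Phi>_auto by (auto simp: auto_def)
  ultimately show ?thesis
    by (simp add: AutoGroup_def BijGroup_def)
qed

lemma inverse_automorphism:
  assumes "\<phi> \<in> \<Phi>"
  obtains \<psi> where "\<psi> \<in> \<Phi>" "\<And>x. x \<in> carrier G \<Longrightarrow> \<psi> (\<phi> x) = x"
proof
  let ?\<psi> = "inv\<^bsub>AutoGroup G\<^esub> \<phi>"
  show \<psi>: "?\<psi> \<in> \<Phi>"
    using fpf assms by (auto simp: fpf_automorphism_group_def intro: subgroup.m_inv_closed)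
  have "?\<psi> \<otimes>\<^bsub>AutoGroup G\<^esub> \<phi> = \<one>\<^bsub>AutoGroup G\<^esub>"
    using \<Phi>_auto[OF assms] by (intro group.l_inv[OF AutoGroup]) (simp add: AutoGroup_def)
  moreover have "\<phi> \<in> Bij (carrier G)" "?\<psi> \<in> Bij (carrier G)"
    using assms \<psi> \<Phi>_auto by (auto simp: auto_def)
  ultimately have "compose (carrier G) ?\<psi> \<phi> = (\<lambda>x\<in>carrier G. x)"
    by (simp add: AutoGroup_def BijGroup_def)
  then show "?\<psi> (\<phi> x) = x" if "x \<in> carrier G" for x
    using that by (metis compose_eq restrict_apply')
qed

text \<open>Keeps the translate of \<open>S\<close> by \<open>\<phi>\<close> inside the set of maps
  on which evaluation at a nonzero point is injective.\<close>

lemma compose_right_closed: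
  assumes "\<alpha> \<in> \<Phi> \<union> {zero_map G}" "\<phi> \<in> \<Phi>"
  shows "compose (carrier G) \<alpha> \<phi> \<in> \<Phi> \<union> {zero_map G}"
proof (cases "\<alpha> \<in> \<Phi>")
  case True
  then show ?thesis
    using assms(2) compose_closed by blast
next
  case False
  then have "compose (carrier G) \<alpha> \<phi> = zero_map G"
    using assms hom[of \<phi>] by (auto simp: compose_def zero_map_def fun_eq_iff dest: hom_in_carrier)
  then show ?thesis by simp
qed

section \<open>The blocks S(x) and the fibres of x -> S(x)\<close>

lemma card_values_at:
  assumes "S \<subseteq> \<Phi> \<union> {zero_map G}" "x \<in> nonzero G"
  shows "card (values_at S x) = card S"
  unfolding values_at_eq_image
  by (rule card_image) (rule inj_on_subset[OF inj_on_eval[OF assms(2)] assms(1)])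

lemma values_at_closed:
  assumes "S \<subseteq> \<Phi> \<union> {zero_map G}" "x \<in> nonzero G"
  shows "values_at S x \<subseteq> carrier G"
proof -
  have "\<alpha> x \<in> carrier G" if "\<alpha> \<in> S" for \<alpha>
    using that assms hom hom_in_carrier[of \<alpha> G G x] by (auto simp: nonzero_def)
  then show ?thesis
    by (auto simp: values_at_def)
qed

text \<open>Evaluation at \<open>x\<close> maps the right stabilizer of \<open>S\<close> in
  \<open>\<Phi>\<close> bijectively onto the fibre through \<open>x\<close>. This stabilizer does
  not involve \<open>x\<close>, so all fibres are equally large.\<close>

lemma card_fibre:
  assumes S: "S \<subseteq> \<Phi> \<union> {zero_map G}" "1 < card S" and x: "x \<in> nonzero G"
  shows "card {y \<in> nonzero G. values_at S y = values_at S x} =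
    card {\<phi> \<in> \<Phi>. (\<lambda>s. compose (carrier G) s \<phi>) ` S = S}"
proof -
  let ?H = "{\<phi> \<in> \<Phi>. (\<lambda>s. compose (carrier G) s \<phi>) ` S = S}"
  have xG: "x \<in> carrier G"
    using x by (simp add: nonzero_def)
  have val: "values_at S (\<phi> x) = values_at ((\<lambda>s. compose (carrier G) s \<phi>) ` S) x" for \<phi>
    using xG by (auto simp: values_at_eq_image compose_eq image_image)
  have "{y \<in> nonzero G. values_at S y = values_at S x} = (\<lambda>\<phi>. \<phi> x) ` ?H"
  proof (intro equalityI subsetI)
    fix y assume "y \<in> {y \<in> nonzero G. values_at S y = values_at S x}"
    then have y: "y \<in> nonzero G" "values_at S y = values_at S x"
      by auto
    \<comment> \<open>With more than one element, \<open>S\<close> contains some \<open>s\<close> in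
      \<open>\<Phi>\<close>. Its value \<open>s x\<close> is nonzero and equals some
      \<open>t y\<close>, so \<open>t\<close> is not the zero map. Hence \<open>t\<close> is
      invertible, and undoing it after \<open>s\<close> sends \<open>x\<close> to
      \<open>y\<close>.\<close>
    have "\<not> S \<subseteq> {zero_map G}"
      using S(2) card_mono[of "{zero_map G}" S] by auto
    then obtain s where s: "s \<in> S" "s \<in> \<Phi>"
      using S(1) by blast
    then obtain t where t: "t \<in> S" "s x = t y"
      using y(2) by (auto simp: values_at_def)
    have "t y \<noteq> \<one>"
      using automorphism_nonzero[OF s(2) x] t(2) by (simp add: nonzero_def)
    then have "t \<in> \<Phi>"
      using t(1) S(1) y(1) by (auto simp: zero_map_def nonzero_def)
    then obtain u where u: "u \<in> \<Phi>" "\<And>z. z \<in> carrier G \<Longrightarrow> u (t z) = z"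
      by (rule inverse_automorphism) blast
    define \<phi> where "\<phi> = compose (carrier G) u s"
    have \<phi>: "\<phi> \<in> \<Phi>"
      unfolding \<phi>_def using u(1) s(2) by (rule compose_closed)
    have \<phi>x: "\<phi> x = y"
      using xG y(1) t(2) u(2) by (simp add: \<phi>_def compose_eq nonzero_def)
    have "(\<lambda>\<alpha>. \<alpha> x) ` ((\<lambda>s. compose (carrier G) s \<phi>) ` S) = (\<lambda>\<alpha>. \<alpha> x) ` S"
      using y(2) val[of \<phi>] \<phi>x by (simp add: values_at_eq_image)
    \<comment> \<open>Injectivity of evaluation at \<open>x\<close> lifts equality of the values to
      equality of the sets of maps.\<close>
    then have "(\<lambda>s. compose (carrier G) s \<phi>) ` S = S"
      using compose_right_closed[OF _ \<phi>] S(1)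
      by (subst (asm) inj_on_image_eq_iff[OF inj_on_eval[OF x]]) blast+
    with \<phi> \<phi>x show "y \<in> (\<lambda>\<phi>. \<phi> x) ` ?H"
      by blast
  next
    fix y assume "y \<in> (\<lambda>\<phi>. \<phi> x) ` ?H"
    then show "y \<in> {y \<in> nonzero G. values_at S y = values_at S x}"
      using automorphism_nonzero[OF _ x] val by auto
  qed
  moreover have "inj_on (\<lambda>\<phi>. \<phi> x) ?H"
    by (rule inj_on_subset[OF inj_on_eval[OF x]]) auto
  ultimately show ?thesis
    by (simp add: card_image)
qed

section \<open>Representing a nonzero element as a difference\<close>

lemma inj_on_difference:
  assumes st: "s \<in> \<Phi> \<union> {zero_map G}" "t \<in> \<Phi> \<union> {zero_map G}" "s \<noteq> t"
  shows "inj_on (\<lambda>x. s x \<otimes> inv (t x)) (carrier G)"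
proof (rule inj_onI)
  fix x y assume xy: "x \<in> carrier G" "y \<in> carrier G" and eq: "s x \<otimes> inv (t x) = s y \<otimes> inv (t y)"
  interpret s: group_hom G G s
    using hom[OF st(1)] by unfold_locales
  interpret t: group_hom G G t
    using hom[OF st(2)] by unfold_locales
  \<comment> \<open>Without commutativity the quotient has to be \<open>inv y \<otimes> x\<close>:
    the factor \<open>s x \<otimes> inv (t x)\<close> then appears unbroken in the middle and can be
    exchanged by \<open>eq\<close>.\<close>
  have "s (inv y \<otimes> x) = inv (s y) \<otimes> (s x \<otimes> inv (t x)) \<otimes> t x"
    using xy by (simp add: m_assoc)
  also have "\<dots> = t (inv y \<otimes> x)"
    unfolding eq using xy by (simp add: m_assoc[symmetric])
  finally have "inv y \<otimes> x \<notin> nonzero G"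
    using inj_onD[OF inj_on_eval _ st(1,2)] st(3) by blast
  then have "inv y \<otimes> x = \<one>"
    using xy by (simp add: nonzero_def)
  then show "x = y"
    using xy by (metis inv_closed inv_equality inv_inv)
qed

text \<open>An injective self-map of a finite set is onto. The preimage of \<open>d\<close> is
  nonzero because this map fixes the neutral element.\<close>

lemma unique_difference:
  assumes st: "s \<in> \<Phi> \<union> {zero_map G}" "t \<in> \<Phi> \<union> {zero_map G}" "s \<noteq> t" and d: "d \<in> nonzero G"
  shows "\<exists>!x. x \<in> nonzero G \<and> s x \<otimes> inv (t x) = d"
proof -
  let ?f = "\<lambda>x. s x \<otimes> inv (t x)"
  have h: "s \<in> hom G G" "t \<in> hom G G"
    using st hom by auto
  have inj: "inj_on ?f (carrier G)"
    using st by (rule inj_on_difference)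
  have "?f ` carrier G = carrier G"
    by (rule endo_inj_surj[OF finite_carrier _ inj]) (use h hom_in_carrier in fastforce)
  then obtain x where x: "x \<in> carrier G" "?f x = d"
    using d by (metis (no_types, lifting) DiffD1 imageE nonzero_def)
  have "?f \<one> = \<one>"
    using h[THEN hom_one[OF _ group_axioms group_axioms]] by simp
  then have "x \<in> nonzero G"
    using x d by (auto simp: nonzero_def)
  with x(2) inj show ?thesis
    by (intro ex1I[of _ x]) (auto simp: nonzero_def dest: inj_onD)
qed

text \<open>The triples correspond to ordered pairs of distinct elements of \<open>S\<close>: the
  pair fixes the one point where its difference is \<open>d\<close>, and the two values at that
  point recover the pair.\<close>

lemma card_family_differences:
  assumes S: "S \<subseteq> \<Phi> \<union> {zero_map G}" and d: "d \<in> nonzero G"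
  shows "card {(x, a, b). x \<in> nonzero G \<and> a \<in> values_at S x \<and> b \<in> values_at S x \<and> a \<otimes> inv b = d} =
    card S * (card S - 1)"
proof -
  let ?D = "{(x, a, b). x \<in> nonzero G \<and> a \<in> values_at S x \<and> b \<in> values_at S x \<and> a \<otimes> inv b = d}"
  let ?P = "SIGMA s:S. S - {s}"
  define w where "w = (\<lambda>(s, t). THE x. x \<in> nonzero G \<and> s x \<otimes> inv (t x) = d)"
  have w: "w (s, t) \<in> nonzero G" "s (w (s, t)) \<otimes> inv (t (w (s, t))) = d"
    "\<And>x. x \<in> nonzero G \<Longrightarrow> s x \<otimes> inv (t x) = d \<Longrightarrow> w (s, t) = x" if "(s, t) \<in> ?P" for s t
  proof -
    have u: "\<exists>!x. x \<in> nonzero G \<and> s x \<otimes> inv (t x) = d"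
      using that S d by (intro unique_difference) auto
    show "w (s, t) \<in> nonzero G" "s (w (s, t)) \<otimes> inv (t (w (s, t))) = d"
      using theI'[OF u] by (auto simp: w_def)
    show "w (s, t) = x" if "x \<in> nonzero G" "s x \<otimes> inv (t x) = d" for x
      unfolding w_def using the1_equality[OF u] that by auto
  qed
  have "bij_betw (\<lambda>(s, t). (w (s, t), s (w (s, t)), t (w (s, t)))) ?P ?D"
    unfolding bij_betw_def
  proof (intro conjI equalityI subsetI)
    show "inj_on (\<lambda>(s, t). (w (s, t), s (w (s, t)), t (w (s, t)))) ?P"
    proof (rule inj_onI)
      fix p q assume pq: "p \<in> ?P" "q \<in> ?P"
        and eq: "(\<lambda>(s, t). (w (s, t), s (w (s, t)), t (w (s, t)))) p =
          (\<lambda>(s, t). (w (s, t), s (w (s, t)), t (w (s, t)))) q"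
      obtain s t s' t' where p: "p = (s, t)" and q: "q = (s', t')"
        by fastforce
      \<comment> \<open>Equal triples share their first entry, so all four maps are compared at the
        same nonzero point.\<close>
      have inj: "inj_on (\<lambda>\<alpha>. \<alpha> (w (s, t))) S"
        using inj_on_eval[OF w(1)] pq(1) p S by (blast intro: inj_on_subset)
      have "s (w (s, t)) = s' (w (s, t))" "t (w (s, t)) = t' (w (s, t))"
        using eq p q by auto
      then have "s = s'" "t = t'"
        using inj_onD[OF inj] pq p q by auto
      then show "p = q"
        using p q by simp
    qed
  next
    fix p assume "p \<in> (\<lambda>(s, t). (w (s, t), s (w (s, t)), t (w (s, t)))) ` ?P"
    then show "p \<in> ?D"
      using w by (auto simp: values_at_def)
  next
    fix p assume "p \<in> ?D"
    then obtain x s t where p: "p = (x, s x, t x)" "x \<in> nonzero G" "s \<in> S" "t \<in> S"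
      "s x \<otimes> inv (t x) = d"
      by (auto simp: values_at_def)
    have "t x \<in> carrier G"
      using p(2,4) values_at_closed[OF S] by (auto simp: values_at_def)
    \<comment> \<open>Equal maps would have the neutral element as difference.\<close>
    then have "s \<noteq> t"
      using p(5) d by (auto simp: nonzero_def)
    then have "(s, t) \<in> ?P"
      using p by auto
    moreover from this have "w (s, t) = x"
      using w(3) p by blast
    ultimately show "p \<in> (\<lambda>(s, t). (w (s, t), s (w (s, t)), t (w (s, t)))) ` ?P"
      using p(1) by (intro image_eqI[of _ _ "(s, t)"]) auto
  qed
  moreover have "finite S"
    using S finite_\<Phi> by (auto intro: finite_subset)
  ultimately show ?thesis
    by (simp add: bij_betw_same_card[symmetric] card_SigmaI)
qed

end

theorem proposition3p1:
  fixes G :: "('a, 'b) monoid_scheme"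
    and \<Phi> S :: "('a \<Rightarrow> 'a) set"
    and \<mu> \<nu> :: nat
  assumes "group G" and "finite (carrier G)" and "1 < order G"
    and "fpf_automorphism_group G \<Phi>"
    and "S \<subseteq> \<Phi> \<union> {zero_map G}" and "1 < card S"
    and "0 < \<mu>" and "0 < \<nu>"
    and "\<forall>a\<in>nonzero G. card (translation_stabilizer G (values_at S a)) = \<mu>"
    and "\<forall>a\<in>nonzero G. card (block_class G (nonzero G) (values_at S) a) = \<nu>"
  shows "sdf_data G (nonzero G) (values_at S)
           (order G) (card S) \<mu> \<nu> (card S * (card S - 1)) \<and>
         short_difference_family G {values_at S x | x. x \<in> nonzero G}
           (order G) (card S) (of_nat (card S * (card S - 1)) / (of_nat \<mu> * of_nat \<nu>))"
proof -
  interpret fpf_automorphisms G \<Phi>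
    using assms(1,2,4) by (simp add: fpf_automorphisms_def fpf_automorphisms_axioms_def)
  \<comment> \<open>Stabilizer and class sizes are given; block size and difference count come from
    the locale, and \<open>1 < card S\<close> makes the count positive.\<close>
  have sdf: "sdf_data G (nonzero G) (values_at S)
      (order G) (card S) \<mu> \<nu> (card S * (card S - 1))"
    unfolding sdf_data_def
    using assms card_values_at[OF assms(5)] values_at_closed[OF assms(5)]
      card_family_differences[OF assms(5)]
    by (intro conjI) auto
  have "finite (nonzero G)"
    using assms(2) by (simp add: nonzero_def)
  moreover have "nonzero G \<noteq> {}"
    using assms(3) by (rule nonzero_nonempty)
  \<comment> \<open>The common fibre size \<open>m\<close> is the order of the right stabilizer of
    \<open>S\<close> in \<open>\<Phi>\<close>.\<close>
  ultimately have "short_difference_family G (values_at S ` nonzero G)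
      (order G) (card S) (of_nat (card S * (card S - 1)) / (of_nat \<mu> * of_nat \<nu>))"
    by (rule short_difference_family_image[OF sdf]) (use card_fibre[OF assms(5,6)] in auto)
  moreover have "{values_at S x | x. x \<in> nonzero G} = values_at S ` nonzero G"
    by auto
  ultimately show ?thesis
    using sdf by simp
qed

end
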